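(* Let $s\ge1$ and suppose that $(\hat U,\hat V)$ is a local solution (local minimizer) of the problem of minimizing $F_\lambda(U,V)$ over $(U,V)\in\mathcal{U}^{d\times s}\times\mathcal{V}^{d\times s}$, that $\hat U$ has no zero column, and that $\hat X=\hat U\hat V^T$ is not a global minimizer of $f_\lambda$ over $\mathbb{R}^{d\times d}$. Let $\mu\in\mathbb{R}^d$ be the Lagrangian multiplier associated with $(\hat U,\hat V)$. Then there exist $\bar{\mathbf{u}},\bar{\mathbf{v}}\in\mathbb{R}^d$ with $$\bar{\mathbf{u}}^T\left(\mu\mathbf{1}_d^T-\nabla g(\hat X)\right)\bar{\mathbf{v}}>\lambda,\qquad \bar{\mathbf{u}},\bar{\mathbf{v}}\ge0,\qquad \|\bar{\mathbf{u}}\|_2=\|\bar{\mathbf{v}}\|_2=1. \qquad( * )$$ Moreover, for any $\bar{\mathbf{u}},\bar{\mathbf{v}}$ satisfying $( * )$ and for some sufficiently small $\kappa>0$, the matrices $$\bar U=\left[\ \mathrm{diag}\{\mathbf{1}_d-\kappa\bar{\mathbf{u}}\}\,\hat U\quad \kappa\bar{\mathbf{u}}\ \right],\qquad \bar V=\left[\ \hat V\quad (\bar{\mathbf{v}}^T\mathbf{1}_d)^{-1}\bar{\mathbf{v}}\ \right]$$ satisfy $(\bar U,\bar V)\in\mathcal{U}^{d\times(s+1)}\times\mathcal{V}^{d\times(s+1)}$ and $$F_\lambda(\bar U,\bar V)<F_\lambda(\hat U,\hat V).$$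
   Context: Data: integers $d,n\ge1$ and a trajectory $(i_0,\dots,i_n)$ of states in $\{1,\dots,d\}$. Put $\hat\xi_j=\frac1n\#\{1\le t\le n: i_t=j\}$ and $\hat\Xi=\mathrm{diag}\{\hat\xi\}\in\mathbb{R}^{d\times d}$. Let $\hat P\in\mathbb{R}^{d\times d}$ be the empirical transition matrix: $\hat p_{ij}=\frac{\#\{1\le t\le n:\ i_{t-1}=i,\ i_t=j\}}{\#\{1\le t\le n:\ i_{t-1}=i\}}$ if the denominator is at least $1$, and $\hat p_{ij}=1/d$ otherwise. Define $g(X)=\frac12\|\hat\Xi(\hat P-X)\|_F^2$ for $X\in\mathbb{R}^{d\times d}$; $\nabla g$ is its gradient. The regularization parameter is $\lambda>0$. $\mathcal{E}=\{X\in\mathbb{R}^{d\times d}: X\mathbf{1}_d=\mathbf{1}_d\}$, and $\chi_{\mathcal{E}}(X)=0$ if $X\in\mathcal{E}$, $+\infty$ otherwise. The atomic regularizer is $\Omega(X)=\inf\left\{\sum_{j=1}^m\|U_j\|_2\|V_j\|_2 : X=UV^T,\ U,V\in\mathbb{R}_+^{d\times m},\ m\ge1\right\}$ ($+\infty$ if no such factorization exists). The convex objective is $f_\lambda(X)=g(X)+\chi_{\mathcal{E}}(X)+\lambda\Omega(X)$. For every integer $m\ge1$: $\mathcal{U}^{d\times m}=\{U\in\mathbb{R}_+^{d\times m}:U\mathbf{1}_m=\mathbf{1}_d\}$ and $\mathcal{V}^{d\times m}=\{V\in\mathbb{R}_+^{d\times m}:V^T\mathbf{1}_d=\mathbf{1}_m\}$,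 where $\mathbb{R}_+^{p\times q}$ is the set of entrywise nonnegative matrices, and for $U,V$ with $m$ columns, $F_\lambda(U,V)=g(UV^T)+\lambda\sum_{j=1}^m\|U_j\|_2\|V_j\|_2$. Lagrangian multiplier: for a local solution $(\hat U,\hat V)$ with no zero column in $\hat U$, and $\hat X=\hat U\hat V^T$, there is a unique $\mu\in\mathbb{R}^d$ with $\left[\mu\mathbf{1}_{s}^T-\nabla g(\hat X)\hat V\right]_+=\lambda\hat U\,\mathrm{diag}\{\|\hat V_j\|_2/\|\hat U_j\|_2\}_{j=1}^s$ and $\left[\mathbf{1}_d\mu^T\hat U-(\nabla g(\hat X))^T\hat U\right]_+=\lambda\hat V\,\mathrm{diag}\{\|\hat U_j\|_2/\|\hat V_j\|_2\}_{j=1}^s$; this $\mu$ is called the Lagrangian multiplier. $A_j$ is the $j$-th column of $A$; $([A]_+)_{ij}=\max\{a_{ij},0\}$; $\mathbf{1}_p$ is the all-one vector in $\mathbb{R}^p$; $\mathrm{diag}$ denotes a diagonal matrix; $[A\ \ \mathbf{b}]$ denotes $A$ with the column $\mathbf{b}$ appended. *)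

theory Defs
  imports "HOL-Analysis.Analysis"
begin

text \<open>
  Conventions. A real \<open>p \<times> q\<close> matrix is a \<^typ>\<open>real^'q^'p\<close>, so the library norm on
  \<^typ>\<open>real^'d^'d\<close> is the Frobenius norm and its inner product is the trace inner product.
  The states are the elements of a finite type \<open>'d\<close>, so \<open>d = CARD('d) \<ge> 1\<close>; the columns of
  a factor are indexed by a finite type \<open>'m\<close>, so \<open>m = CARD('m) \<ge> 1\<close>; appending a column
  passes from \<open>'m\<close> to \<^typ>\<open>'m option\<close>. The vector \<open>1 :: real^'n\<close> is the all-one vector.
  A trajectory \<open>(i\<^sub>0, \<dots>, i\<^sub>n)\<close> is a function \<open>tr\<close> on \<^typ>\<open>nat\<close> of which only the values
  at \<open>0, \<dots>, n\<close> are used.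
\<close>

definition nonneg_mat :: "real^'q^'p \<Rightarrow> bool" where
  "nonneg_mat A \<longleftrightarrow> (\<forall>i j. 0 \<le> A $ i $ j)"

definition pos_part :: "real^'q^'p \<Rightarrow> real^'q^'p" where
  "pos_part A = (\<chi> i j. max (A $ i $ j) 0)"

definition diag :: "real^'p \<Rightarrow> real^'p^'p" where
  "diag a = (\<chi> i j. if i = j then a $ i else 0)"

definition outer :: "real^'p \<Rightarrow> real^'q \<Rightarrow> real^'q^'p" where
  "outer a b = (\<chi> i j. a $ i * b $ j)"

definition append_col :: "real^'m^'p \<Rightarrow> real^'p \<Rightarrow> real^('m option)^'p" where
  "append_col A b = (\<chi> i j. case j of None \<Rightarrow> b $ i | Some k \<Rightarrow> A $ i $ k)"

definition xi_hat :: "nat \<Rightarrow> (nat \<Rightarrow> 'd) \<Rightarrow> real^'d" where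
  "xi_hat n tr = (\<chi> j. real (card {t \<in> {1..n}. tr t = j}) / real n)"

definition P_hat :: "nat \<Rightarrow> (nat \<Rightarrow> 'd) \<Rightarrow> real^'d^'d" where
  "P_hat n tr = (\<chi> i j.
     if card {t \<in> {1..n}. tr (t - 1) = i} \<ge> 1
     then real (card {t \<in> {1..n}. tr (t - 1) = i \<and> tr t = j}) /
          real (card {t \<in> {1..n}. tr (t - 1) = i})
     else 1 / real CARD('d))"

definition g :: "nat \<Rightarrow> (nat \<Rightarrow> 'd::finite) \<Rightarrow> real^'d^'d \<Rightarrow> real" where
  "g n tr X = 1 / 2 * (norm (diag (xi_hat n tr) ** (P_hat n tr - X)))\<^sup>2"

definition grad_g :: "nat \<Rightarrow> (nat \<Rightarrow> 'd::finite) \<Rightarrow> real^'d^'d \<Rightarrow> real^'d^'d" where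
  "grad_g n tr X = (THE D. GDERIV (g n tr) X :> D)"

definition chi_E :: "real^'d^'d \<Rightarrow> ereal" where
  "chi_E X = (if X *v 1 = 1 then 0 else \<infinity>)"

text \<open>
  The number \<open>m\<close> of columns is bound inside the infimum, so here the factors are given by their
  columns \<open>u 0, \<dots>, u (m - 1)\<close> and \<open>v 0, \<dots>, v (m - 1)\<close>, and \<open>X = U V\<^sup>T\<close> is written
  entrywise. In \<^typ>\<open>ereal\<close> the infimum of the empty set is \<open>\<infinity>\<close>.
\<close>

definition Omega :: "real^'d^'d \<Rightarrow> ereal" where
  "Omega X = Inf {ereal (\<Sum>j<m. norm (u j) * norm (v j)) | (m::nat) (u :: nat \<Rightarrow> real^'d) v.
     m \<ge> 1 \<and> (\<forall>j<m. \<forall>i. 0 \<le> u j $ i \<and> 0 \<le> v j $ i) \<and>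
     X = (\<chi> i k. \<Sum>j<m. u j $ i * v j $ k)}"

definition f_obj :: "nat \<Rightarrow> (nat \<Rightarrow> 'd::finite) \<Rightarrow> real \<Rightarrow> real^'d^'d \<Rightarrow> ereal" where
  "f_obj n tr lam X = ereal (g n tr X) + chi_E X + ereal lam * Omega X"

definition U_set :: "(real^'m^'d) set" where
  "U_set = {U. nonneg_mat U \<and> U *v 1 = 1}"

definition V_set :: "(real^'m^'d) set" where
  "V_set = {V. nonneg_mat V \<and> transpose V *v 1 = 1}"

definition F_obj ::
  "nat \<Rightarrow> (nat \<Rightarrow> 'd::finite) \<Rightarrow> real \<Rightarrow> real^'m^'d \<Rightarrow> real^'m^'d \<Rightarrow> real" where
  "F_obj n tr lam U V =
     g n tr (U ** transpose V) + lam * (\<Sum>j\<in>UNIV. norm (column j U) * norm (column j V))"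

definition local_solution ::
  "nat \<Rightarrow> (nat \<Rightarrow> 'd::finite) \<Rightarrow> real \<Rightarrow> real^'m^'d \<Rightarrow> real^'m^'d \<Rightarrow> bool" where
  "local_solution n tr lam U V \<longleftrightarrow>
     (U, V) \<in> U_set \<times> V_set \<and>
     (\<exists>e>0. \<forall>(U', V') \<in> U_set \<times> V_set.
        dist (U', V') (U, V) < e \<longrightarrow> F_obj n tr lam U V \<le> F_obj n tr lam U' V')"

definition lagrange_multiplier ::
  "nat \<Rightarrow> (nat \<Rightarrow> 'd::finite) \<Rightarrow> real \<Rightarrow> real^'m^'d \<Rightarrow> real^'m^'d \<Rightarrow> real^'d \<Rightarrow> bool" where
  "lagrange_multiplier n tr lam U V mu \<longleftrightarrow>
     (let G = grad_g n tr (U ** transpose V) in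
        pos_part (outer mu 1 - G ** V) =
          lam *\<^sub>R (U ** diag (\<chi> j. norm (column j V) / norm (column j U))) \<and>
        pos_part (outer 1 mu ** U - transpose G ** U) =
          lam *\<^sub>R (V ** diag (\<chi> j. norm (column j U) / norm (column j V))))"

text \<open>The condition \<open>(*)\<close> on \<open>(u, v)\<close>, with \<open>G\<close> in the role of the gradient.\<close>

definition escape_pair :: "real \<Rightarrow> real^'d \<Rightarrow> real^'d^'d \<Rightarrow> real^'d \<Rightarrow> real^'d \<Rightarrow> bool" where
  "escape_pair lam mu G u v \<longleftrightarrow>
     u \<bullet> ((outer mu 1 - G) *v v) > lam \<and>
     (\<forall>i. 0 \<le> u $ i) \<and> (\<forall>i. 0 \<le> v $ i) \<and> norm u = 1 \<and> norm v = 1"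

end

theory Submission
  imports Defs
begin

text \<open>
  Write \<open>M = \<mu> 1\<^sup>T - G\<close> with \<open>G\<close> the gradient at \<open>X\<close>. Since the columns of \<open>V\<close> sum to one,
  the first multiplier equation says \<open>[M V\<^sub>j]\<^sub>+ = \<lambda> (\<parallel>V\<^sub>j\<parallel> / \<parallel>U\<^sub>j\<parallel>) U\<^sub>j\<close>, hence
  \<open>U\<^sub>i\<^sub>j (M V\<^sub>j)\<^sub>i = \<lambda> (\<parallel>V\<^sub>j\<parallel> / \<parallel>U\<^sub>j\<parallel>) U\<^sub>i\<^sub>j\<^sup>2\<close>. If \<open>u\<^sup>T M v \<le> \<lambda>\<close> for all nonnegative unit
  vectors, convexity of \<open>g\<close> and \<open>\<langle>\<mu> 1\<^sup>T, Y - X\<rangle> = 0\<close> on the affine set make \<open>X\<close> a global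
  minimizer. Otherwise, along the curve \<open>\<kappa> \<mapsto> (U', V')\<close> the terms coming from the rescaling of
  \<open>U\<close> cancel, and the derivative of the objective at \<open>\<kappa> = 0\<close> is \<open>(\<lambda> - u\<^sup>T M v) / (v\<^sup>T 1) < 0\<close>.
\<close>

section \<open>Trace inner product, outer products and appended columns\<close>

lemma inner_mat: "A \<bullet> B = (\<Sum>i\<in>UNIV. \<Sum>j\<in>UNIV. A $ i $ j * B $ i $ j)" for A B :: "real^'q^'p"
  by (simp add: inner_vec_def)

lemma inner_outer: "(A :: real^'q^'p) \<bullet> outer u v = u \<bullet> (A *v v)"
  by (simp add: inner_vec_def matrix_vector_mult_def outer_def sum_distrib_left mult_ac)

lemma outer_one_inner: "outer mu 1 \<bullet> (A :: real^'q^'p) = mu \<bullet> (A *v 1)"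
  by (simp add: inner_vec_def matrix_vector_mult_def outer_def sum_distrib_left mult_ac)

lemma outer_mult_vec: "outer a b *v x = (b \<bullet> x) *\<^sub>R a"
  by (simp add: vec_eq_iff inner_vec_def matrix_vector_mult_def outer_def sum_distrib_left mult_ac)

lemma diag_mult_nth: "(diag a ** A) $ i $ j = a $ i * A $ i $ j"
  by (simp add: matrix_matrix_mult_def diag_def if_distrib if_distribR cong: if_cong)

lemma mult_diag_nth: "(A ** diag a) $ i $ j = A $ i $ j * a $ j"
  by (simp add: matrix_matrix_mult_def diag_def if_distrib if_distribR cong: if_cong)

lemma inner_diag_mult: "A \<bullet> (diag a ** B) = (diag a ** A) \<bullet> (B :: real^'q^'p)"
  by (simp add: inner_mat diag_mult_nth mult_ac)

lemma mult_transpose_eq_sum_outer: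
  "(A :: real^'m^'p) ** transpose B = (\<Sum>j\<in>UNIV. outer (column j A) (column j B))"
  by (simp add: vec_eq_iff matrix_matrix_mult_def transpose_def outer_def column_def)

lemma column_append_col [simp]:
  "column None (append_col A b) = b" "column (Some j) (append_col A b) = column j A"
  by (simp_all add: vec_eq_iff column_def append_col_def)

lemma sum_UNIV_option: "(\<Sum>j\<in>UNIV. f j) = f None + (\<Sum>j\<in>UNIV. f (Some j))"
  for f :: "'m::finite option \<Rightarrow> 'b::comm_monoid_add"
  by (simp add: UNIV_option_conv sum.reindex)

lemma nonneg_mat_append_col:
  "nonneg_mat (append_col A b) \<longleftrightarrow> nonneg_mat A \<and> (\<forall>i. 0 \<le> b $ i)"
  unfolding nonneg_mat_def append_col_def
  by (auto split: option.splits)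

lemma append_col_mult_one: "append_col A b *v 1 = A *v 1 + b"
  by (simp add: vec_eq_iff matrix_vector_mult_def sum_UNIV_option append_col_def)

section \<open>Gradient and convexity of the quadratic loss\<close>

lemma linear_matrix_mult: "linear (\<lambda>X :: real^'q^'p. (A :: real^'p^'r) ** X)"
  by (rule linearI)
    (simp_all add: vec_eq_iff matrix_matrix_mult_def distrib_left sum.distrib sum_distrib_left mult_ac)

text \<open>The loss is quadratic, so this expansion is exact. Its nonnegative last term gives
  convexity, and along a line it is of second order in the parameter.\<close>

lemma g_expansion:
  "g n tr (X + H) = g n tr X
     + (diag (xi_hat n tr) ** (diag (xi_hat n tr) ** (X - P_hat n tr))) \<bullet> H
     + 1 / 2 * (norm (diag (xi_hat n tr) ** H))\<^sup>2"
proof -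
  let ?D = "diag (xi_hat n tr)" and ?P = "P_hat n tr"
  have "?D ** (?P - (X + H)) = ?D ** (?P - X) - ?D ** H"
    by (simp add: vec_eq_iff diag_mult_nth algebra_simps)
  then have "(norm (?D ** (?P - (X + H))))\<^sup>2
      = (norm (?D ** (?P - X)))\<^sup>2 - 2 * ((?D ** (?P - X)) \<bullet> (?D ** H)) + (norm (?D ** H))\<^sup>2"
    by (simp add: power2_norm_eq_inner inner_diff inner_commute)
  moreover have "(?D ** (?D ** (X - ?P))) \<bullet> H = - ((?D ** (?P - X)) \<bullet> (?D ** H))"
    by (simp add: inner_mat diag_mult_nth algebra_simps sum_subtractf)
  ultimately show ?thesis
    by (simp add: g_def)
qed

lemma GDERIV_g:
  "GDERIV (g n tr) X :> diag (xi_hat n tr) ** (diag (xi_hat n tr) ** (X - P_hat n tr))"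
proof -
  let ?D = "diag (xi_hat n tr)" and ?P = "P_hat n tr"
  have "((\<lambda>X. ?D ** (?P - X)) has_derivative (\<lambda>H. ?D ** (0 - H))) (at X)"
    by (rule bounded_linear.has_derivative[OF linear_conv_bounded_linear[THEN iffD1, OF linear_matrix_mult]])
      (auto intro!: derivative_eq_intros)
  then have "(g n tr has_derivative
      (\<lambda>H. 1 / 2 * ((?D ** (?P - X)) \<bullet> (?D ** (0 - H)) + (?D ** (0 - H)) \<bullet> (?D ** (?P - X))))) (at X)"
    unfolding g_def power2_norm_eq_inner
    by (intro has_derivative_mult_right has_derivative_inner)
  moreover have "1 / 2 * ((?D ** (?P - X)) \<bullet> (?D ** (0 - H)) + (?D ** (0 - H)) \<bullet> (?D ** (?P - X)))
      = H \<bullet> (?D ** (?D ** (X - ?P)))" for H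
    by (simp add: inner_mat diag_mult_nth algebra_simps sum_subtractf sum_negf)
  ultimately show ?thesis
    unfolding gderiv_def by (simp add: fun_eq_iff)
qed

lemma GDERIV_unique: "GDERIV f x :> D \<Longrightarrow> GDERIV f x :> E \<Longrightarrow> D = E"
  unfolding gderiv_def
  by (drule (1) has_derivative_unique) (metis vector_eq_ldot)

text \<open>\<open>grad_g\<close> is a definite description, so its value is known only after
  existence and uniqueness of the gradient.\<close>

lemma grad_g_eq:
  "grad_g n tr X = diag (xi_hat n tr) ** (diag (xi_hat n tr) ** (X - P_hat n tr))"
  unfolding grad_g_def by (intro the_equality GDERIV_g GDERIV_unique[OF _ GDERIV_g])

lemma g_expansion_grad:
  "g n tr (X + H) = g n tr X + grad_g n tr X \<bullet> H + 1 / 2 * (norm (diag (xi_hat n tr) ** H))\<^sup>2"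
  unfolding grad_g_eq by (rule g_expansion)

lemma g_convex: "g n tr Y \<ge> g n tr X + grad_g n tr X \<bullet> (Y - X)"
  using g_expansion_grad[of n tr X "Y - X"] by simp

section \<open>Feasible factors and the multiplier equation\<close>

lemma V_set_iff: "V \<in> V_set \<longleftrightarrow> nonneg_mat V \<and> (\<forall>j. column j V \<bullet> 1 = 1)"
  unfolding V_set_def
  by (simp add: vec_eq_iff matrix_vector_mult_def transpose_def inner_vec_def column_def
      del: transpose_matrix_vector)

lemma V_set_sum_column: "V \<in> V_set \<Longrightarrow> 1 \<bullet> column j V = 1"
  by (simp add: V_set_iff inner_commute)

lemma feasible_product_mult_one:
  assumes "U \<in> U_set" "V \<in> V_set"
  shows "(U ** transpose V) *v 1 = 1"
  using assms by (simp add: U_set_def V_set_def matrix_vector_mul_assoc[symmetric])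

text \<open>Multiplying by \<open>U $ i $ j\<close> removes the positive part: where the entry of
  \<open>M *v column j V\<close> is negative, the multiplier equation forces
  \<open>U $ i $ j\<close> to vanish, so both sides are zero.\<close>

lemma lagrange_multiplier_column:
  assumes "lagrange_multiplier n tr lam U V mu" "lam > 0" "U \<in> U_set" "V \<in> V_set"
  defines "M \<equiv> outer mu 1 - grad_g n tr (U ** transpose V)"
  shows "U $ i $ j * (M *v column j V) $ i
    = lam * (U $ i $ j)\<^sup>2 * norm (column j V) / norm (column j U)"
proof -
  let ?G = "grad_g n tr (U ** transpose V)"
  have "pos_part (outer mu 1 - ?G ** V) =
      lam *\<^sub>R (U ** diag (\<chi> j. norm (column j V) / norm (column j U)))"
    using assms(1) by (simp add: lagrange_multiplier_def Let_def)
  then have "pos_part (outer mu 1 - ?G ** V) $ i $ j =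
      (lam *\<^sub>R (U ** diag (\<chi> j. norm (column j V) / norm (column j U)))) $ i $ j"
    by simp
  moreover have "(?G ** V) $ i $ j = (?G *v column j V) $ i"
    by (simp add: matrix_vector_mult_def matrix_matrix_mult_def column_def)
  ultimately have *: "max (mu $ i - (?G *v column j V) $ i) 0
      = lam * U $ i $ j * norm (column j V) / norm (column j U)"
    by (simp add: pos_part_def outer_def mult_diag_nth)
  \<comment> \<open>Because \<open>column j V\<close> sums to one, \<open>outer mu 1\<close> maps it
    to \<open>mu\<close>.\<close>
  have "M *v column j V = mu - ?G *v column j V"
    by (simp add: M_def matrix_vector_mult_diff_rdistrib outer_mult_vec V_set_sum_column[OF assms(4)])
  with * have **: "max ((M *v column j V) $ i) 0
      = lam * U $ i $ j * norm (column j V) / norm (column j U)" by simp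
  show ?thesis
  proof (cases "(M *v column j V) $ i \<ge> 0")
    case True
    with ** show ?thesis by (simp add: power2_eq_square)
  next
    case False
    with ** have "lam * U $ i $ j * norm (column j V) / norm (column j U) = 0" by simp
    moreover have "norm (column j V) \<noteq> 0"
      using V_set_sum_column[OF assms(4), of j] by auto
    \<comment> \<open>With the convention x / 0 = 0, the vanishing quotient says nothing about a
      zero column, so that case is settled directly.\<close>
    moreover have "U $ i $ j = 0" if "norm (column j U) = 0"
      using that by (simp add: vec_eq_iff column_def)
    ultimately have "U $ i $ j = 0"
      using \<open>lam > 0\<close> by auto
    then show ?thesis by simp
  qed
qed

section \<open>The atomic regularizer and the certificate of global optimality\<close>

lemma Omega_nonneg: "Omega Y \<ge> 0"
  unfolding Omega_def by (rule Inf_greatest) (auto intro!: sum_nonneg)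

lemma Omega_product_le:
  assumes "nonneg_mat U" "nonneg_mat V"
  shows "Omega (U ** transpose V) \<le>
    ereal (\<Sum>j\<in>UNIV. norm (column j U) * norm (column j (V :: real^'s::finite^'d)))"
proof -
  \<comment> \<open>\<open>Omega\<close> numbers the columns by naturals, the factors by a finite
    type; \<open>h\<close> translates.\<close>
  obtain h where h: "bij_betw h {..<CARD('s)} (UNIV :: 's set)"
    using ex_bij_betw_nat_finite[OF finite_class.finite_UNIV] by (metis atLeast0LessThan)
  show ?thesis
    unfolding Omega_def mem_Collect_eq
  proof (rule Inf_lower, safe, intro exI conjI)
    show "ereal (\<Sum>j\<in>UNIV. norm (column j U) * norm (column j V))
      = ereal (\<Sum>j<CARD('s). norm (column (h j) U) * norm (column (h j) V))"
      by (simp add: sum.reindex_bij_betw[OF h, symmetric])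
    show "1 \<le> CARD('s)" by (simp add: Suc_le_eq)
    show "\<forall>j<CARD('s). \<forall>i. 0 \<le> column (h j) U $ i \<and> 0 \<le> column (h j) V $ i"
      using assms by (simp add: nonneg_mat_def column_def)
    show "U ** transpose V
      = (\<chi> i k. \<Sum>j<CARD('s). column (h j) U $ i * column (h j) V $ k)"
      by (simp add: vec_eq_iff matrix_matrix_mult_def transpose_def column_def
          sum.reindex_bij_betw[OF h, symmetric])
  qed
qed

text \<open>Splitting the product into outer products of columns reduces the pairing to the
  entrywise identity for \<open>M *v column j V\<close>. The unweighted form is complementarity at
  \<open>X\<close>; the weighted form measures the effect of shrinking the rows of
  \<open>U\<close>.\<close>

lemma lagrange_multiplier_pairing:
  assumes "lagrange_multiplier n tr lam U V mu" "lam > 0" "U \<in> U_set" "V \<in> V_set"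
  defines "M \<equiv> outer mu 1 - grad_g n tr (U ** transpose V)"
  shows "M \<bullet> (U ** transpose V) = lam * (\<Sum>j\<in>UNIV. norm (column j U) * norm (column j V))"
    and "M \<bullet> (diag u ** (U ** transpose V))
      = lam * (\<Sum>j\<in>UNIV. (\<Sum>i\<in>UNIV. u $ i * (U $ i $ j)\<^sup>2) * norm (column j V) / norm (column j U))"
proof -
  note col = lagrange_multiplier_column[OF assms(1-4), folded M_def]
  have weighted: "M \<bullet> (diag u ** (U ** transpose V))
      = lam * (\<Sum>j\<in>UNIV. (\<Sum>i\<in>UNIV. u $ i * (U $ i $ j)\<^sup>2) * norm (column j V) / norm (column j U))" for u
  proof -
    have "M \<bullet> (diag u ** (U ** transpose V)) = (\<Sum>j\<in>UNIV. column j U \<bullet> ((diag u ** M) *v column j V))"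
      by (simp add: inner_diag_mult mult_transpose_eq_sum_outer inner_sum_right inner_outer)
    also have "\<dots> = (\<Sum>j\<in>UNIV. \<Sum>i\<in>UNIV. u $ i * (U $ i $ j * (M *v column j V) $ i))"
      by (simp add: inner_vec_def matrix_vector_mult_def diag_mult_nth column_def sum_distrib_left mult_ac)
    also have "\<dots> = lam * (\<Sum>j\<in>UNIV. (\<Sum>i\<in>UNIV. u $ i * (U $ i $ j)\<^sup>2) * norm (column j V) / norm (column j U))"
      by (simp add: col sum_distrib_left sum_distrib_right sum_divide_distrib mult_ac)
    finally show ?thesis .
  qed
  show "M \<bullet> (diag u ** (U ** transpose V))
      = lam * (\<Sum>j\<in>UNIV. (\<Sum>i\<in>UNIV. u $ i * (U $ i $ j)\<^sup>2) * norm (column j V) / norm (column j U))"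
    by (rule weighted)
  \<comment> \<open>For weight one, the inner sum is the squared column norm, one factor of which
    cancels the denominator.\<close>
  have "diag 1 ** (U ** transpose V) = U ** transpose V"
    by (simp add: vec_eq_iff diag_mult_nth)
  moreover have "(\<Sum>i\<in>UNIV. (U $ i $ j)\<^sup>2) = norm (column j U) * norm (column j U)" for j
    by (simp only: power2_eq_square[symmetric] power2_norm_eq_inner)
      (simp add: inner_vec_def column_def power2_eq_square)
  ultimately show "M \<bullet> (U ** transpose V) = lam * (\<Sum>j\<in>UNIV. norm (column j U) * norm (column j V))"
    using weighted[of 1] by (auto intro!: sum.cong)
qed

text \<open>Both sides are positively homogeneous in \<open>u\<close> and in \<open>v\<close>, so
  normalizing suffices.\<close>

lemma inner_mult_le_of_unit:
  fixes M :: "real^'q^'p"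
  assumes unit: "\<And>u v. (\<forall>i. 0 \<le> u $ i) \<Longrightarrow> (\<forall>i. 0 \<le> v $ i) \<Longrightarrow> norm u = 1 \<Longrightarrow> norm v = 1
      \<Longrightarrow> u \<bullet> (M *v v) \<le> c"
    and "\<forall>i. 0 \<le> u $ i" "\<forall>i. 0 \<le> v $ i"
  shows "u \<bullet> (M *v v) \<le> c * (norm u * norm v)"
proof (cases "u = 0 \<or> v = 0")
  case False
  have "(u /\<^sub>R norm u) \<bullet> (M *v (v /\<^sub>R norm v)) \<le> c"
    using assms False by (intro unit) auto
  with False show ?thesis
    by (simp add: matrix_vector_mult_scaleR field_simps)
qed auto

lemma global_minimizer_of_unit_bound:
  fixes U V :: "real^'s::finite^'d::finite"
  defines "X \<equiv> U ** transpose V"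
  assumes mult: "lagrange_multiplier n tr lam U V mu" "lam > 0" "U \<in> U_set" "V \<in> V_set"
    and unit: "\<And>u v. (\<forall>i. 0 \<le> u $ i) \<Longrightarrow> (\<forall>i. 0 \<le> v $ i) \<Longrightarrow> norm u = 1 \<Longrightarrow> norm v = 1
      \<Longrightarrow> u \<bullet> ((outer mu 1 - grad_g n tr X) *v v) \<le> lam"
  shows "f_obj n tr lam X \<le> f_obj n tr lam Y"
proof (cases "Y *v 1 = 1")
  case False
  have "0 \<le> ereal lam * Omega Y"
    using Omega_nonneg[of Y] \<open>lam > 0\<close> by simp
  with False show ?thesis by (auto simp: f_obj_def chi_E_def)
next
  case Y1: True
  define M where "M = outer mu 1 - grad_g n tr X"
  define S where "S = (\<Sum>j\<in>UNIV. norm (column j U) * norm (column j V))"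
  have X1: "X *v 1 = 1"
    unfolding X_def using mult by (intro feasible_product_mult_one)
  have MX: "M \<bullet> X = lam * S"
    unfolding M_def X_def S_def by (rule lagrange_multiplier_pairing(1)[OF mult])
  \<comment> \<open>\<open>Y - X\<close> annihilates the all-one vector, hence is orthogonal to
    \<open>outer mu 1\<close>; in the gradient inequality the gradient may thus be replaced by
    \<open>- M\<close>.\<close>
  have low: "g n tr X + lam * S \<le> g n tr Y + M \<bullet> Y"
  proof -
    have "grad_g n tr X \<bullet> (Y - X) = outer mu 1 \<bullet> (Y - X) - M \<bullet> (Y - X)"
      by (simp add: M_def inner_diff_left)
    also have "\<dots> = lam * S - M \<bullet> Y"
      by (simp add: inner_diff_right outer_one_inner X1 Y1 MX)
    finally show ?thesis
      using g_convex[of n tr X Y] by simp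
  qed
  \<comment> \<open>Solved for \<open>Omega Y\<close>, the bound can be checked on one factorization
    at a time; it holds vacuously if there is none.\<close>
  have "ereal ((g n tr X - g n tr Y) / lam + S) \<le> Omega Y"
    unfolding Omega_def
  proof (rule Inf_greatest)
    fix z assume "z \<in> {ereal (\<Sum>j<m. norm (u j) * norm (v j)) | (m::nat) (u :: nat \<Rightarrow> real^'d) v.
      m \<ge> 1 \<and> (\<forall>j<m. \<forall>i. 0 \<le> u j $ i \<and> 0 \<le> v j $ i) \<and>
      Y = (\<chi> i k. \<Sum>j<m. u j $ i * v j $ k)}"
    then obtain m :: nat and u v :: "nat \<Rightarrow> real^'d"
      where z: "z = ereal (\<Sum>j<m. norm (u j) * norm (v j))"
        and uv: "\<forall>j<m. \<forall>i. 0 \<le> u j $ i \<and> 0 \<le> v j $ i"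
        and Y: "Y = (\<chi> i k. \<Sum>j<m. u j $ i * v j $ k)" by blast
    have "Y = (\<Sum>j<m. outer (u j) (v j))"
      by (simp add: Y vec_eq_iff outer_def)
    then have "M \<bullet> Y = (\<Sum>j<m. u j \<bullet> (M *v v j))"
      by (simp add: inner_sum_right inner_outer)
    also have "\<dots> \<le> (\<Sum>j<m. lam * (norm (u j) * norm (v j)))"
      using uv unit unfolding M_def by (intro sum_mono inner_mult_le_of_unit) auto
    finally have "g n tr X + lam * S \<le> g n tr Y + lam * (\<Sum>j<m. norm (u j) * norm (v j))"
      using low by (simp add: sum_distrib_left)
    then show "ereal ((g n tr X - g n tr Y) / lam + S) \<le> z"
      using \<open>lam > 0\<close> by (simp add: z field_simps)
  qed
  then have "ereal lam * ereal ((g n tr X - g n tr Y) / lam + S) \<le> ereal lam * Omega Y"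
    using \<open>lam > 0\<close> by (intro ereal_mult_left_mono) auto
  moreover have "lam * ((g n tr X - g n tr Y) / lam + S) = g n tr X + lam * S - g n tr Y"
    using \<open>lam > 0\<close> by (simp add: field_simps)
  ultimately have "ereal (g n tr X + lam * S - g n tr Y) \<le> ereal lam * Omega Y"
    by simp
  then have "ereal (g n tr X + lam * S) \<le> ereal (g n tr Y) + ereal lam * Omega Y"
    by (cases "ereal lam * Omega Y") auto
  \<comment> \<open>The given factors compete in the infimum for \<open>Omega X\<close>, so
    \<open>S\<close> bounds it from above.\<close>
  moreover have "ereal lam * Omega X \<le> ereal lam * ereal S"
    unfolding X_def S_def using mult
    by (intro ereal_mult_left_mono Omega_product_le) (auto simp: U_set_def V_set_def)
  then have "ereal (g n tr X) + ereal lam * Omega X \<le> ereal (g n tr X + lam * S)"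
    using add_left_mono[of _ _ "ereal (g n tr X)"] by fastforce
  ultimately have "ereal (g n tr X) + ereal lam * Omega X \<le> ereal (g n tr Y) + ereal lam * Omega Y"
    by order
  then show ?thesis by (simp add: f_obj_def chi_E_def X1 Y1)
qed

section \<open>The escape curve: feasibility, objective value and slope at zero\<close>

lemma sum_pos_of_unit:
  fixes v :: "real^'d"
  assumes "\<forall>i. 0 \<le> v $ i" "norm v = 1"
  shows "v \<bullet> 1 > 0"
proof -
  have "v \<bullet> 1 = (\<Sum>i\<in>UNIV. v $ i)" by (simp add: inner_vec_def)
  moreover have "v \<noteq> 0" using assms(2) by auto
  then obtain i where "v $ i \<noteq> 0" by (auto simp: vec_eq_iff)
  with assms(1) have "(\<Sum>i\<in>UNIV. v $ i) > 0"
    by (intro sum_pos2[of _ i]) (auto simp: less_le)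
  ultimately show ?thesis by simp
qed

text \<open>Entries of the unit vector \<open>u\<close> are at most one, so the rescaled rows stay
  nonnegative. Row \<open>i\<close> loses mass \<open>kappa * u $ i\<close>, which the new column
  restores.\<close>

lemma escape_curve_feasible:
  fixes U V :: "real^'s::finite^'d::finite"
  assumes "U \<in> U_set" "V \<in> V_set" "\<forall>i. 0 \<le> u $ i" "\<forall>i. 0 \<le> v $ i" "norm u = 1" "norm v = 1"
    and "0 \<le> kappa" "kappa \<le> 1"
  shows "append_col (diag (1 - kappa *\<^sub>R u) ** U) (kappa *\<^sub>R u) \<in> U_set"
    and "append_col V (inverse (v \<bullet> 1) *\<^sub>R v) \<in> V_set"
proof -
  have "kappa * u $ i \<le> 1" for i
    using component_le_norm_cart[of u i] assms(3,5,7,8) by (intro mult_le_one) auto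
  then have "nonneg_mat (diag (1 - kappa *\<^sub>R u) ** U)"
    using assms(1) by (simp add: nonneg_mat_def U_set_def diag_mult_nth)
  moreover have "(diag (1 - kappa *\<^sub>R u) ** U) *v 1 + kappa *\<^sub>R u = 1"
  proof -
    have "(diag (1 - kappa *\<^sub>R u) ** U) *v 1 = diag (1 - kappa *\<^sub>R u) *v 1"
      using assms(1) by (simp add: U_set_def matrix_vector_mul_assoc[symmetric])
    also have "\<dots> = 1 - kappa *\<^sub>R u"
      by (simp add: vec_eq_iff matrix_vector_mult_def diag_def)
    finally show ?thesis by simp
  qed
  ultimately show "append_col (diag (1 - kappa *\<^sub>R u) ** U) (kappa *\<^sub>R u) \<in> U_set"
    using assms by (simp add: U_set_def nonneg_mat_append_col append_col_mult_one)
  show "append_col V (inverse (v \<bullet> 1) *\<^sub>R v) \<in> V_set"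
    using assms sum_pos_of_unit[of v]
    by (simp add: V_set_iff nonneg_mat_append_col split_option_all)
qed

text \<open>The product moves along a straight line from \<open>X\<close>, and so does each old
  column of \<open>U\<close>; this form can be differentiated term by term.\<close>

lemma escape_curve_value:
  fixes U V :: "real^'s::finite^'d::finite"
  defines "X \<equiv> U ** transpose V"
  assumes "norm u = 1" "norm v = 1" "v \<bullet> 1 > 0" "kappa \<ge> 0"
  shows "F_obj n tr lam (append_col (diag (1 - kappa *\<^sub>R u) ** U) (kappa *\<^sub>R u))
      (append_col V (inverse (v \<bullet> 1) *\<^sub>R v))
    = g n tr (X + kappa *\<^sub>R (inverse (v \<bullet> 1) *\<^sub>R outer u v - diag u ** X))
      + lam * (kappa / (v \<bullet> 1)
        + (\<Sum>j\<in>UNIV. norm (column j U - kappa *\<^sub>R column j (diag u ** U)) * norm (column j V)))"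
proof -
  have "append_col (diag (1 - kappa *\<^sub>R u) ** U) (kappa *\<^sub>R u)
        ** transpose (append_col V (inverse (v \<bullet> 1) *\<^sub>R v))
      = outer (kappa *\<^sub>R u) (inverse (v \<bullet> 1) *\<^sub>R v) + (diag (1 - kappa *\<^sub>R u) ** U) ** transpose V"
    by (simp add: mult_transpose_eq_sum_outer sum_UNIV_option)
  also have "\<dots> = outer (kappa *\<^sub>R u) (inverse (v \<bullet> 1) *\<^sub>R v) + diag (1 - kappa *\<^sub>R u) ** X"
    by (simp add: X_def matrix_mul_assoc)
  also have "\<dots> = X + kappa *\<^sub>R (inverse (v \<bullet> 1) *\<^sub>R outer u v - diag u ** X)"
    by (simp add: vec_eq_iff diag_mult_nth outer_def algebra_simps)
  finally have "append_col (diag (1 - kappa *\<^sub>R u) ** U) (kappa *\<^sub>R u)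
        ** transpose (append_col V (inverse (v \<bullet> 1) *\<^sub>R v))
      = X + kappa *\<^sub>R (inverse (v \<bullet> 1) *\<^sub>R outer u v - diag u ** X)" .
  moreover have "column j (diag (1 - kappa *\<^sub>R u) ** U) = column j U - kappa *\<^sub>R column j (diag u ** U)" for j
    by (simp add: vec_eq_iff column_def diag_mult_nth algebra_simps)
  ultimately show ?thesis
    using assms by (simp add: F_obj_def sum_UNIV_option divide_inverse)
qed

text \<open>The norm is the square root of a quadratic in \<open>t\<close> that is positive at zero
  because \<open>a\<close> is nonzero.\<close>

lemma DERIV_norm_line:
  fixes a b :: "'a::real_inner"
  assumes "a \<noteq> 0"
  shows "((\<lambda>t. norm (a - t *\<^sub>R b)) has_real_derivative - (a \<bullet> b) / norm a) (at 0)"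
proof -
  have "((\<lambda>t. sqrt ((norm a)\<^sup>2 - 2 * t * (a \<bullet> b) + t\<^sup>2 * (norm b)\<^sup>2))
      has_real_derivative - (a \<bullet> b) / norm a) (at 0)"
    using assms by (auto intro!: derivative_eq_intros simp: field_simps)
  moreover have "norm (a - t *\<^sub>R b) = sqrt ((norm a)\<^sup>2 - 2 * t * (a \<bullet> b) + t\<^sup>2 * (norm b)\<^sup>2)" for t
    by (simp add: norm_eq_sqrt_inner inner_diff inner_commute power2_eq_square algebra_simps)
  ultimately show ?thesis by simp
qed

lemma DERIV_g_line:
  "((\<lambda>t. g n tr (X + t *\<^sub>R H)) has_real_derivative grad_g n tr X \<bullet> H) (at 0)"
proof -
  have "diag (xi_hat n tr) ** (t *\<^sub>R H) = t *\<^sub>R (diag (xi_hat n tr) ** H)" for t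
    by (simp add: vec_eq_iff diag_mult_nth)
  then show ?thesis
    by (auto intro!: derivative_eq_intros simp: g_expansion_grad power_mult_distrib)
qed

text \<open>The weighted pairing turns the first-order loss change from \<open>diag u ** X\<close>
  into the exact opposite of the change in the old column norms, leaving only the new column's
  contribution.\<close>

lemma escape_slope:
  fixes U V :: "real^'s::finite^'d::finite"
  defines "X \<equiv> U ** transpose V"
  assumes mult: "lagrange_multiplier n tr lam U V mu" "lam > 0" "U \<in> U_set" "V \<in> V_set"
    and "v \<bullet> 1 > 0"
  shows "grad_g n tr X \<bullet> (inverse (v \<bullet> 1) *\<^sub>R outer u v - diag u ** X)
      + lam * (1 / (v \<bullet> 1)
        + (\<Sum>j\<in>UNIV. - (column j U \<bullet> column j (diag u ** U)) / norm (column j U) * norm (column j V)))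
    = (lam - u \<bullet> ((outer mu 1 - grad_g n tr X) *v v)) / (v \<bullet> 1)"
proof -
  define M where "M = outer mu 1 - grad_g n tr X"
  define H where "H = inverse (v \<bullet> 1) *\<^sub>R outer u v - diag u ** X"
  have X1: "X *v 1 = 1"
    unfolding X_def using mult by (intro feasible_product_mult_one)
  \<comment> \<open>Both terms of \<open>H\<close> send the all-one vector to \<open>u\<close>, so
    pairing with \<open>outer mu 1\<close> gives zero.\<close>
  have "H *v 1 = inverse (v \<bullet> 1) *\<^sub>R (outer u v *v 1) - diag u *v (X *v 1)"
    by (simp add: H_def matrix_vector_mult_diff_rdistrib scaleR_matrix_vector_assoc matrix_vector_mul_assoc)
  also have "\<dots> = 0"
    using \<open>v \<bullet> 1 > 0\<close> by (simp add: X1 outer_mult_vec) (simp add: vec_eq_iff matrix_vector_mult_def diag_def)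
  finally have H1: "H *v 1 = 0" .
  have "grad_g n tr X \<bullet> H = outer mu 1 \<bullet> H - M \<bullet> H"
    by (simp add: M_def inner_diff_left)
  also have "\<dots> = M \<bullet> (diag u ** X) - u \<bullet> (M *v v) / (v \<bullet> 1)"
    by (simp add: outer_one_inner H1) (simp add: H_def inner_diff_right inner_outer divide_inverse mult.commute)
  also have "M \<bullet> (diag u ** X) = lam * (\<Sum>j\<in>UNIV. (column j U \<bullet> column j (diag u ** U)) / norm (column j U) * norm (column j V))"
    unfolding M_def X_def lagrange_multiplier_pairing(2)[OF mult]
    by (simp add: inner_vec_def column_def diag_mult_nth power2_eq_square mult_ac)
  finally show ?thesis
    unfolding H_def[symmetric] M_def[symmetric]
    by (simp add: sum_negf algebra_simps diff_divide_distrib)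
qed

theorem theorem5p3:
  fixes n :: nat and tr :: "nat \<Rightarrow> 'd::finite" and lam :: real
    and U V :: "real^'s::finite^'d" and X :: "real^'d^'d" and mu :: "real^'d"
  assumes "n \<ge> 1"
    and "lam > 0"
    and "local_solution n tr lam U V"
    and "\<forall>j. column j U \<noteq> 0"
    and "X = U ** transpose V"
    and "\<not> (\<forall>Y. f_obj n tr lam X \<le> f_obj n tr lam Y)"
    and "lagrange_multiplier n tr lam U V mu"
  shows "(\<exists>u v. escape_pair lam mu (grad_g n tr X) u v) \<and>
    (\<forall>u v. escape_pair lam mu (grad_g n tr X) u v \<longrightarrow>
      (\<forall>eps>0. \<exists>kappa. 0 < kappa \<and> kappa < eps \<and>
        (let U' = append_col (diag (1 - kappa *\<^sub>R u) ** U) (kappa *\<^sub>R u);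
             V' = append_col V (inverse (v \<bullet> 1) *\<^sub>R v)
         in (U', V') \<in> U_set \<times> V_set \<and> F_obj n tr lam U' V' < F_obj n tr lam U V)))"
proof (intro conjI allI impI)
  have UV: "U \<in> U_set" "V \<in> V_set"
    using assms(3) by (auto simp: local_solution_def)
  note mult = assms(7,2) UV
  show "\<exists>u v. escape_pair lam mu (grad_g n tr X) u v"
  proof (rule ccontr)
    assume "\<nexists>u v. escape_pair lam mu (grad_g n tr X) u v"
    then have "f_obj n tr lam X \<le> f_obj n tr lam Y" for Y
      unfolding assms(5) escape_pair_def
      by (intro global_minimizer_of_unit_bound[OF mult]) (meson not_le)
    with assms(6) show False by blast
  qed
  fix u v and eps :: real
  assume pair: "escape_pair lam mu (grad_g n tr X) u v" and "eps > 0"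
  then have uv: "\<forall>i. 0 \<le> u $ i" "\<forall>i. 0 \<le> v $ i" "norm u = 1" "norm v = 1"
    by (auto simp: escape_pair_def)
  have v1: "v \<bullet> 1 > 0"
    using uv by (intro sum_pos_of_unit)
  \<comment> \<open>\<open>phi\<close> is defined for all real \<open>kappa\<close>, so it has a
    two-sided derivative at zero. It is identified with the objective on the curve only for
    \<open>kappa\<close> at least zero, where the norm of \<open>kappa *\<^sub>R u\<close> is
    \<open>kappa\<close>.\<close>
  define phi where "phi kappa = g n tr (X + kappa *\<^sub>R (inverse (v \<bullet> 1) *\<^sub>R outer u v - diag u ** X))
      + lam * (kappa / (v \<bullet> 1)
        + (\<Sum>j\<in>UNIV. norm (column j U - kappa *\<^sub>R column j (diag u ** U)) * norm (column j V)))" for kappa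
  have "(phi has_real_derivative (lam - u \<bullet> ((outer mu 1 - grad_g n tr X) *v v)) / (v \<bullet> 1)) (at 0)"
    unfolding phi_def assms(5) escape_slope[OF mult v1, symmetric]
    using assms(4)
    by (intro DERIV_add DERIV_cmult DERIV_sum DERIV_cmult_right DERIV_g_line DERIV_norm_line DERIV_cdivide DERIV_ident)
      auto
  moreover have "(lam - u \<bullet> ((outer mu 1 - grad_g n tr X) *v v)) / (v \<bullet> 1) < 0"
    using pair v1 by (simp add: escape_pair_def divide_neg_pos)
  ultimately obtain d where d: "d > 0" "\<And>h. h > 0 \<Longrightarrow> h < d \<Longrightarrow> phi h < phi 0"
    using DERIV_neg_dec_right[of phi _ 0] by auto
  \<comment> \<open>Halving makes the bounds by \<open>d\<close> (descent) and \<open>eps\<close>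
    strict; the bound by one gives feasibility.\<close>
  define kappa where "kappa = min 1 (min d eps) / 2"
  have kappa: "0 < kappa" "kappa < eps" "kappa < d" "kappa \<le> 1"
    using d(1) \<open>eps > 0\<close> by (auto simp: kappa_def)
  have "phi 0 = F_obj n tr lam U V"
    by (simp add: phi_def F_obj_def assms(5))
  then have "F_obj n tr lam (append_col (diag (1 - kappa *\<^sub>R u) ** U) (kappa *\<^sub>R u))
      (append_col V (inverse (v \<bullet> 1) *\<^sub>R v)) < F_obj n tr lam U V"
    using d(2)[OF kappa(1,3)] escape_curve_value[OF uv(3,4) v1, of kappa n tr lam U V] kappa(1)
    by (simp add: phi_def assms(5))
  then show "\<exists>kappa. 0 < kappa \<and> kappa < eps \<and>
        (let U' = append_col (diag (1 - kappa *\<^sub>R u) ** U) (kappa *\<^sub>R u);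
             V' = append_col V (inverse (v \<bullet> 1) *\<^sub>R v)
         in (U', V') \<in> U_set \<times> V_set \<and> F_obj n tr lam U' V' < F_obj n tr lam U V)"
    unfolding Let_def
    using kappa escape_curve_feasible[OF UV uv, of kappa] by (intro exI[of _ kappa]) simp
qed

end
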